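(* As $q\to\infty$, \[ \alpha(4,q)=\lambda_3 q^4+o(q^4), \qquad\text{with}\qquad \frac{91}{240}\le \lambda_3\le \frac{11}{28}. \] Equivalently, $\frac{91}{240}q^4+o(q^4)\le \alpha(4,q)\le \frac{11}{28}q^4+o(q^4)$. The same asymptotic estimate also holds for $\alpha_{\operatorname{loop}}(4,q)$.
   Context: Let $[q]:=\{0,\dots,q-1\}$. The de Bruijn digraph $B(4,q)$ has vertex set $[q]^4$ and edges $x_1x_2x_3x_4\to x_2x_3x_4y$, $y\in[q]$. In its underlying simple graph (loops deleted), distinct words $x_1\dots x_4$ and $y_1\dots y_4$ are adjacent iff $x_2x_3x_4=y_1y_2y_3$ or $y_2y_3y_4=x_1x_2x_3$. $\alpha(4,q)$ is the independence number of this simple graph; $\alpha_{\operatorname{loop}}(4,q)$ is the maximum size of an independent set of this simple graph containing no constant word $a^4$ (independence number with loops retained). For measurable $A\subseteq[0,1]^3$, $\Phi_3(A):=\int_{[0,1]^4}\mathbf 1_A(x_1,x_2,x_3)(1-\mathbf 1_A(x_2,x_3,x_4))\,dx$, and $\lambda_3:=\sup_A\Phi_3(A)$ over measurable $A\subseteq[0,1]^3$. *)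

theory Defs
  imports "HOL-Analysis.Analysis" "HOL-Library.Ramsey" "HOL-Library.Landau_Symbols"
begin

type_synonym word4 = "nat \<times> nat \<times> nat \<times> nat"

definition words :: "nat \<Rightarrow> word4 set" where
  "words q = {..<q} \<times> {..<q} \<times> {..<q} \<times> {..<q}"

definition de_bruijn_arcs :: "nat \<Rightarrow> (word4 \<times> word4) set" where
  "de_bruijn_arcs q =
     {((x1, x2, x3, x4), (x2, x3, x4, y)) | x1 x2 x3 x4 y.
        (x1, x2, x3, x4) \<in> words q \<and> y \<in> {..<q}}"

text \<open>The underlying simple graph, as a set of two-element vertex sets: orientation is
  forgotten and the loops at the constant words are deleted.\<close>

definition de_bruijn_edges :: "nat \<Rightarrow> word4 set set" where
  "de_bruijn_edges q = {{u, v} | u v. (u, v) \<in> de_bruijn_arcs q \<and> u \<noteq> v}"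

lemma de_bruijn_adjacent_iff:
  assumes "(x1, x2, x3, x4) \<in> words q" "(y1, y2, y3, y4) \<in> words q"
    and "(x1, x2, x3, x4) \<noteq> (y1, y2, y3, y4)"
  shows "{(x1, x2, x3, x4), (y1, y2, y3, y4)} \<in> de_bruijn_edges q \<longleftrightarrow>
    (x2, x3, x4) = (y1, y2, y3) \<or> (y2, y3, y4) = (x1, x2, x3)"
proof -
  have arc: "((a1, a2, a3, a4), (b1, b2, b3, b4)) \<in> de_bruijn_arcs q
      \<longleftrightarrow> (a2, a3, a4) = (b1, b2, b3)"
    if "(a1, a2, a3, a4) \<in> words q" "(b1, b2, b3, b4) \<in> words q" for a1 a2 a3 a4 b1 b2 b3 b4
    using that by (auto simp: de_bruijn_arcs_def words_def)
  have "{u, v} \<in> de_bruijn_edges q \<longleftrightarrow>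
      (u, v) \<in> de_bruijn_arcs q \<or> (v, u) \<in> de_bruijn_arcs q" if "u \<noteq> v" for u v
    using that unfolding de_bruijn_edges_def mem_Collect_eq doubleton_eq_iff by blast
  then show ?thesis
    using assms arc by simp
qed

definition alpha4 :: "nat \<Rightarrow> nat" where
  "alpha4 q = Max {card S | S. S \<subseteq> words q \<and> indep S (de_bruijn_edges q)}"

definition alpha_loop4 :: "nat \<Rightarrow> nat" where
  "alpha_loop4 q = Max {card S | S. S \<subseteq> words q \<and> indep S (de_bruijn_edges q) \<and>
     (\<forall>a. (a, a, a, a) \<notin> S)}"

definition cube3 :: "(real \<times> real \<times> real) set" where
  "cube3 = {0..1} \<times> {0..1} \<times> {0..1}"

definition cube4 :: "(real \<times> real \<times> real \<times> real) set" where
  "cube4 = {0..1} \<times> {0..1} \<times> {0..1} \<times> {0..1}"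

definition Phi3 :: "(real \<times> real \<times> real) set \<Rightarrow> real" where
  "Phi3 A = (LINT x:cube4|lebesgue.
     (case x of (x1, x2, x3, x4) \<Rightarrow>
        indicator A (x1, x2, x3) * (1 - indicator A (x2, x3, x4))))"

text \<open>``Measurable'' is read as Lebesgue measurable.\<close>

definition lambda3 :: real where
  "lambda3 = (SUP A \<in> {A. A \<in> sets lebesgue \<and> A \<subseteq> cube3}. Phi3 A)"

end

theory Submission
  imports Defs "HOL-Probability.Probability" "HOL-Real_Asymp.Real_Asymp"
begin

text \<open>Up to loops, a maximum independent set consists of the words \<open>wxyz\<close> with \<open>wxy \<in> A\<close> and
  \<open>xyz \<notin> A\<close> for some set \<open>A\<close> of triples. Blowing letters up to intervals gives
  \<open>alpha_loop4 q \<le> lambda3 q\<^sup>4\<close>, while sampling \<open>q\<close> random letters from a set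
  \<open>A \<subseteq> [0,1]\<^sup>3\<close> gives \<open>q (q - 1) (q - 2) (q - 3) lambda3 \<le> alpha_loop4 q\<close>; hence both estimates
  on \<open>lambda3\<close> reduce to finite alphabets.

  For the upper estimate put \<open>f = \<plusminus>1\<close> on and off \<open>A\<close>, and let \<open>I\<close>, \<open>M\<close>, \<open>O\<close> be the averages of \<open>f\<close> over
  its first, middle and last argument. The transition density is \<open>(1 - C) / 4\<close> with
  \<open>C = E f(w,x,y) f(x,y,z) = E I O\<close>. Sign inequalities give \<open>C \<ge> E O\<^sup>2 + E I M - 1\<close> and
  \<open>C \<ge> E I\<^sup>2 + E O M - 1\<close>, so \<open>4 C \<ge> E (I + O)\<^sup>2 + E (I + O) M - 2 \<ge> - E M\<^sup>2 / 4 - 2 \<ge> - 9 / 4\<close>,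
  a transition density of at most \<open>25 / 64 < 11 / 28\<close>. The lower estimate is witnessed by one set of
  triples over nine letters.\<close>

subsection \<open>Independent sets and triple sets\<close>

text \<open>Words of length 4 are the arcs of the de Bruijn digraph on triples, so this is the
  directed cut from \<open>A\<close> to its complement.\<close>

definition transitions :: "nat \<Rightarrow> (nat \<times> nat \<times> nat) set \<Rightarrow> word4 set" where
  "transitions q A = {(w, x, y, z) \<in> words q. (w, x, y) \<in> A \<and> (x, y, z) \<notin> A}"

lemma finite_words [simp]: "finite (words q)"
  by (simp add: words_def)

lemma transitions_subset_words: "transitions q A \<subseteq> words q"
  by (auto simp: transitions_def)

lemma finite_transitions [simp]: "finite (transitions q A)"
  by (rule finite_subset[OF transitions_subset_words]) simp

lemma de_bruijn_edge_iff:
  "{u, v} \<in> de_bruijn_edges q \<longleftrightarrow>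
     u \<noteq> v \<and> ((u, v) \<in> de_bruijn_arcs q \<or> (v, u) \<in> de_bruijn_arcs q)"
  unfolding de_bruijn_edges_def mem_Collect_eq doubleton_eq_iff by blast

text \<open>For adjacent words \<open>wxyz\<close> and \<open>xyzv\<close>, the shared triple
  \<open>xyz\<close> would have to lie both outside and inside \<open>A\<close>.\<close>

lemma indep_transitions: "indep (transitions q A) (de_bruijn_edges q)"
  by (auto simp: indep_def de_bruijn_edge_iff de_bruijn_arcs_def transitions_def)

lemma finite_card_subsets:
  assumes "finite V"
  shows "finite {card S | S. S \<subseteq> V \<and> P S}"
proof (rule finite_surj)
  show "finite (Pow V)" using assms by simp
  show "{card S | S. S \<subseteq> V \<and> P S} \<subseteq> card ` Pow V" by auto
qed

lemma card_le_alpha_loop4: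
  assumes "S \<subseteq> words q" "indep S (de_bruijn_edges q)" "\<And>a. (a, a, a, a) \<notin> S"
  shows "card S \<le> alpha_loop4 q"
  unfolding alpha_loop4_def using assms finite_card_subsets[OF finite_words]
  by (intro Max_ge) auto

lemma card_le_alpha4:
  assumes "S \<subseteq> words q" "indep S (de_bruijn_edges q)"
  shows "card S \<le> alpha4 q"
  unfolding alpha4_def using assms finite_card_subsets[OF finite_words]
  by (intro Max_ge) auto

lemma alpha_loop4_attained:
  obtains S where "S \<subseteq> words q" "indep S (de_bruijn_edges q)" "\<And>a. (a, a, a, a) \<notin> S"
    "card S = alpha_loop4 q"
proof -
  let ?C = "{card S | S. S \<subseteq> words q \<and> indep S (de_bruijn_edges q) \<and> (\<forall>a. (a, a, a, a) \<notin> S)}"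
  have "?C \<noteq> {}"
    by (auto intro!: exI[of _ "{}"])
  then have "alpha_loop4 q \<in> ?C"
    unfolding alpha_loop4_def using finite_card_subsets[OF finite_words] by (intro Max_in) auto
  then show ?thesis
    using that by auto
qed

lemma alpha4_attained:
  obtains S where "S \<subseteq> words q" "indep S (de_bruijn_edges q)" "card S = alpha4 q"
proof -
  let ?C = "{card S | S. S \<subseteq> words q \<and> indep S (de_bruijn_edges q)}"
  have "?C \<noteq> {}"
    by (auto intro!: exI[of _ "{}"])
  then have "alpha4 q \<in> ?C"
    unfolding alpha4_def using finite_card_subsets[OF finite_words] by (intro Max_in) auto
  then show ?thesis
    using that by auto
qed

lemma card_transitions_le_alpha_loop4: "card (transitions q A) \<le> alpha_loop4 q"
  by (intro card_le_alpha_loop4 transitions_subset_words indep_transitions)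
     (auto simp: transitions_def)

text \<open>Take for \<open>A\<close> the prefixes of a maximum set \<open>S\<close>. A word of
  \<open>S\<close> whose suffix is again a prefix would be adjacent to another word of
  \<open>S\<close>.\<close>

lemma alpha_loop4_le_card_transitions:
  obtains A where "alpha_loop4 q \<le> card (transitions q A)"
proof -
  obtain S where S: "S \<subseteq> words q" "indep S (de_bruijn_edges q)" "\<And>a. (a, a, a, a) \<notin> S"
    "card S = alpha_loop4 q"
    by (rule alpha_loop4_attained) blast
  define A where "A = {(w, x, y). \<exists>z. (w, x, y, z) \<in> S}"
  have "S \<subseteq> transitions q A"
  proof
    fix u assume u: "u \<in> S"
    obtain w x y z where u_eq: "u = (w, x, y, z)" by (cases u)
    have "(x, y, z) \<notin> A"
    proof
      assume "(x, y, z) \<in> A"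
      then obtain v where v: "(x, y, z, v) \<in> S" by (auto simp: A_def)
      \<comment> \<open>Equality with its own shift forces \<open>w = x = y = z\<close>, so the
        exclusion of constant words enters exactly here.\<close>
      have "u \<noteq> (x, y, z, v)" using u S(3) by (auto simp: u_eq)
      moreover have "(u, (x, y, z, v)) \<in> de_bruijn_arcs q"
        using u v S(1) by (auto simp: u_eq de_bruijn_arcs_def words_def)
      ultimately have "{u, (x, y, z, v)} \<in> de_bruijn_edges q" by (simp add: de_bruijn_edge_iff)
      then show False using S(2) u v \<open>u \<noteq> _\<close> by (auto simp: indep_def)
    qed
    then show "u \<in> transitions q A"
      using u S(1) by (auto simp: transitions_def A_def u_eq)
  qed
  then have "card S \<le> card (transitions q A)" by (intro card_mono) simp_all
  then show ?thesis using that S(4) by simp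
qed

lemma alpha_loop4_le_alpha4: "alpha_loop4 q \<le> alpha4 q"
  by (rule alpha_loop4_attained[of q]) (metis card_le_alpha4)

text \<open>Deleting the at most \<open>q\<close> constant words from a maximum set leaves one
  admissible for \<open>alpha_loop4\<close>.\<close>

lemma alpha4_le: "alpha4 q \<le> alpha_loop4 q + q"
proof -
  obtain S where S: "S \<subseteq> words q" "indep S (de_bruijn_edges q)" "card S = alpha4 q"
    by (rule alpha4_attained) blast
  let ?L = "(\<lambda>a. (a, a, a, a)) ` {..<q}"
  have "card (S - ?L) \<le> alpha_loop4 q"
  proof (rule card_le_alpha_loop4)
    show "S - ?L \<subseteq> words q" using S(1) by auto
    show "indep (S - ?L) (de_bruijn_edges q)" using S(2) by (rule smaller_indep) auto
    show "(a, a, a, a) \<notin> S - ?L" for a using S(1) by (auto simp: words_def)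
  qed
  moreover have "card S \<le> card ((S - ?L) \<union> ?L)"
    using finite_subset[OF S(1)] by (intro card_mono) auto
  moreover have "card ((S - ?L) \<union> ?L) \<le> card (S - ?L) + card ?L"
    by (rule card_Un_le)
  moreover have "card ?L \<le> q"
    using card_image_le[of "{..<q}"] by simp
  ultimately show ?thesis using S(3) by simp
qed

subsection \<open>Finite bounds\<close>

lemma card_transitions_eq_sum:
  "real (card (transitions q A)) =
     (\<Sum>w<q. \<Sum>x<q. \<Sum>y<q. \<Sum>z<q. of_bool ((w, x, y) \<in> A) * (1 - of_bool ((x, y, z) \<in> A)))"
proof -
  have "real (card (transitions q A)) = (\<Sum>u\<in>words q. of_bool (u \<in> transitions q A))"
    using transitions_subset_words by (simp add: sum.If_cases of_bool_def Int_absorb1)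
  also have "\<dots> = (\<Sum>(w, x, y, z)\<in>words q. of_bool ((w, x, y) \<in> A) * (1 - of_bool ((x, y, z) \<in> A)))"
    by (intro sum.cong) (auto simp: transitions_def)
  also have "\<dots> = (\<Sum>w<q. \<Sum>x<q. \<Sum>y<q. \<Sum>z<q. of_bool ((w, x, y) \<in> A) * (1 - of_bool ((x, y, z) \<in> A)))"
    by (simp only: words_def sum.cartesian_product)
  finally show ?thesis .
qed

lemma sum_swap_inner:
  fixes g :: "'a \<Rightarrow> 'b \<Rightarrow> 'c \<Rightarrow> 'd::comm_monoid_add"
  shows "(\<Sum>x\<in>A. \<Sum>y\<in>B. \<Sum>z\<in>C. g x y z) = (\<Sum>y\<in>B. \<Sum>z\<in>C. \<Sum>x\<in>A. g x y z)"
  by (subst sum.swap) (intro sum.cong refl sum.swap)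

text \<open>The two lower bounds on \<open>C\<close> come from \<open>1 + ab - ac - bc \<ge> 0\<close> for signs,
  with \<open>a = f w x y\<close>, \<open>b = f x y z\<close>, and \<open>c\<close> either \<open>f w x z\<close> or \<open>f w y z\<close>.\<close>

lemma sign_correlation_lower_bound:
  fixes f :: "nat \<Rightarrow> nat \<Rightarrow> nat \<Rightarrow> real"
  assumes sign: "\<And>x y z. f x y z = 1 \<or> f x y z = -1"
  shows "(\<Sum>w<n. \<Sum>x<n. \<Sum>y<n. \<Sum>z<n. f w x y * f x y z) \<ge> - (9 / 16) * real n ^ 4"
proof -
  \<comment> \<open>Unnormalised versions of the averages I, O and M: sums in place of means, so
    powers of \<open>n\<close> appear below.\<close>
  define i where "i x y = (\<Sum>w<n. f w x y)" for x y
  define o' where "o' x y = (\<Sum>z<n. f x y z)" for x y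
  define m where "m x z = (\<Sum>y<n. f x y z)" for x z
  define C where "C = (\<Sum>x<n. \<Sum>y<n. i x y * o' x y)"
  have C_eq: "(\<Sum>w<n. \<Sum>x<n. \<Sum>y<n. \<Sum>z<n. f w x y * f x y z) = C"
    unfolding C_def i_def o'_def by (subst sum_swap_inner) (simp add: sum_product)
  have ineq: "1 + a * b - a * c - b * c \<ge> (0::real)"
    if "a = 1 \<or> a = -1" "b = 1 \<or> b = -1" "c = 1 \<or> c = -1" for a b c
    using that by auto
  \<comment> \<open>Here c is \<open>f w x z\<close>. It shares \<open>w, x\<close> with
    \<open>f w x y\<close>, which sums to a square of \<open>o'\<close>, and \<open>x, z\<close>
    with \<open>f x y z\<close>, which sums to a product of \<open>i\<close> and
    \<open>m\<close>.\<close>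
  have "0 \<le> (\<Sum>w<n. \<Sum>x<n. \<Sum>y<n. \<Sum>z<n.
      1 + f w x y * f x y z - f w x y * f w x z - f x y z * f w x z)"
    by (intro sum_nonneg ineq sign)
  also have "\<dots> = real n ^ 4 + C
      - (\<Sum>w<n. \<Sum>x<n. \<Sum>y<n. \<Sum>z<n. f w x y * f w x z)
      - (\<Sum>w<n. \<Sum>x<n. \<Sum>y<n. \<Sum>z<n. f x y z * f w x z)"
    by (simp add: sum.distrib sum_subtractf C_eq power4_eq_xxxx)
  also have "(\<Sum>w<n. \<Sum>x<n. \<Sum>y<n. \<Sum>z<n. f w x y * f w x z) = (\<Sum>x<n. \<Sum>y<n. (o' x y)\<^sup>2)"
    unfolding o'_def power2_eq_square sum_product ..
  also have "(\<Sum>w<n. \<Sum>x<n. \<Sum>y<n. \<Sum>z<n. f x y z * f w x z) = (\<Sum>x<n. \<Sum>z<n. i x z * m x z)"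
  proof -
    have "(\<Sum>w<n. \<Sum>x<n. \<Sum>y<n. \<Sum>z<n. f x y z * f w x z)
        = (\<Sum>w<n. \<Sum>x<n. \<Sum>z<n. \<Sum>y<n. f x y z * f w x z)"
      by (intro sum.cong refl sum.swap)
    also have "\<dots> = (\<Sum>x<n. \<Sum>z<n. \<Sum>w<n. \<Sum>y<n. f x y z * f w x z)"
      by (rule sum_swap_inner)
    finally show ?thesis by (simp add: i_def m_def sum_product mult.commute)
  qed
  finally have 1: "(\<Sum>x<n. \<Sum>y<n. (o' x y)\<^sup>2) + (\<Sum>x<n. \<Sum>y<n. i x y * m x y) - real n ^ 4 \<le> C"
    by linarith
  \<comment> \<open>The mirror image, with c equal to \<open>f w y z\<close>: the roles of
    \<open>i\<close> and \<open>o'\<close> are exchanged.\<close>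
  have "0 \<le> (\<Sum>w<n. \<Sum>x<n. \<Sum>y<n. \<Sum>z<n.
      1 + f w x y * f x y z - f w x y * f w y z - f x y z * f w y z)"
    by (intro sum_nonneg ineq sign)
  also have "\<dots> = real n ^ 4 + C
      - (\<Sum>w<n. \<Sum>x<n. \<Sum>y<n. \<Sum>z<n. f w x y * f w y z)
      - (\<Sum>w<n. \<Sum>x<n. \<Sum>y<n. \<Sum>z<n. f x y z * f w y z)"
    by (simp add: sum.distrib sum_subtractf C_eq power4_eq_xxxx)
  also have "(\<Sum>w<n. \<Sum>x<n. \<Sum>y<n. \<Sum>z<n. f w x y * f w y z) = (\<Sum>w<n. \<Sum>y<n. m w y * o' w y)"
  proof -
    have "(\<Sum>w<n. \<Sum>x<n. \<Sum>y<n. \<Sum>z<n. f w x y * f w y z)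
        = (\<Sum>w<n. \<Sum>y<n. \<Sum>x<n. \<Sum>z<n. f w x y * f w y z)"
      by (intro sum.cong refl sum.swap)
    then show ?thesis by (simp add: o'_def m_def sum_product)
  qed
  also have "(\<Sum>w<n. \<Sum>x<n. \<Sum>y<n. \<Sum>z<n. f x y z * f w y z) = (\<Sum>y<n. \<Sum>z<n. (i y z)\<^sup>2)"
  proof -
    have "(\<Sum>w<n. \<Sum>x<n. \<Sum>y<n. \<Sum>z<n. f x y z * f w y z)
        = (\<Sum>w<n. \<Sum>y<n. \<Sum>z<n. \<Sum>x<n. f x y z * f w y z)"
      by (intro sum.cong refl sum_swap_inner)
    also have "\<dots> = (\<Sum>y<n. \<Sum>z<n. \<Sum>w<n. \<Sum>x<n. f x y z * f w y z)"
      by (rule sum_swap_inner)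
    finally show ?thesis by (simp add: i_def power2_eq_square sum_product mult.commute)
  qed
  finally have 2: "(\<Sum>x<n. \<Sum>y<n. (i x y)\<^sup>2) + (\<Sum>x<n. \<Sum>y<n. m x y * o' x y) - real n ^ 4 \<le> C"
    by linarith
  \<comment> \<open>Adding both bounds and \<open>2 * C\<close> completes a square pointwise: the
    summand is \<open>(i + o' + m / 2)^2 - m^2 / 4\<close>, and \<open>m\<close> is at most
    \<open>n\<close> in absolute value.\<close>
  have "- (1 / 4) * real n ^ 4 = (\<Sum>x<n. \<Sum>y<n. - (1 / 4) * (real n)\<^sup>2)"
    by (simp add: power2_eq_square power4_eq_xxxx)
  also have "\<dots> \<le> (\<Sum>x<n. \<Sum>y<n. (o' x y)\<^sup>2 + i x y * m x y + (i x y)\<^sup>2 + m x y * o' x y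
      + 2 * (i x y * o' x y))"
  proof (intro sum_mono)
    fix x y
    have "\<bar>m x y\<bar> \<le> (\<Sum>z<n. \<bar>f x z y\<bar>)"
      unfolding m_def by (rule sum_abs)
    also have "\<dots> \<le> (\<Sum>z<n. 1)"
      using sign by (intro sum_mono) (metis abs_minus_cancel abs_one order_refl)
    finally have "(m x y)\<^sup>2 \<le> (real n)\<^sup>2"
      by (simp flip: abs_le_square_iff)
    moreover have "0 \<le> (i x y + o' x y + m x y / 2)\<^sup>2"
      by simp
    ultimately show "- (1 / 4) * (real n)\<^sup>2 \<le> (o' x y)\<^sup>2 + i x y * m x y + (i x y)\<^sup>2
        + m x y * o' x y + 2 * (i x y * o' x y)"
      by (simp add: power2_eq_square algebra_simps)
  qed
  also have "\<dots> \<le> 4 * C + 2 * real n ^ 4"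
    using 1 2 by (simp add: sum.distrib C_def flip: sum_distrib_left)
  finally show ?thesis
    using C_eq by simp
qed

text \<open>In signs, four times the transition indicator is
  \<open>(1 + f w x y) * (1 - f x y z)\<close>. The linear terms cancel after summation, leaving
  \<open>(1 + 9/16) / 4 = 25/64\<close>.\<close>

lemma card_transitions_le: "real (card (transitions q A)) \<le> 25 / 64 * real q ^ 4"
proof -
  define f :: "nat \<Rightarrow> nat \<Rightarrow> nat \<Rightarrow> real" where
    "f x y z = 2 * of_bool ((x, y, z) \<in> A) - 1" for x y z
  have sign: "f x y z = 1 \<or> f x y z = -1" for x y z
    by (simp add: f_def)
  have shift: "(\<Sum>w<q. \<Sum>x<q. \<Sum>y<q. \<Sum>z<q. f w x y) = (\<Sum>w<q. \<Sum>x<q. \<Sum>y<q. \<Sum>z<q. f x y z)"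
    by (simp add: sum_distrib_left)
  have "4 * real (card (transitions q A)) = (\<Sum>w<q. \<Sum>x<q. \<Sum>y<q. \<Sum>z<q.
      1 + f w x y - f x y z - f w x y * f x y z)"
    unfolding card_transitions_eq_sum sum_distrib_left
    by (intro sum.cong refl) (auto simp: f_def)
  also have "\<dots> = real q ^ 4 - (\<Sum>w<q. \<Sum>x<q. \<Sum>y<q. \<Sum>z<q. f w x y * f x y z)"
    unfolding sum.distrib sum_subtractf shift by (simp add: power4_eq_xxxx)
  also have "\<dots> \<le> 25 / 16 * real q ^ 4"
    using sign_correlation_lower_bound[of f q] sign by simp
  finally show ?thesis by simp
qed

text \<open>Found by simulated annealing over \<open>9 \<times> 9\<close> threshold matrices and then regularised;
  the resulting density \<open>2488 / 9\<^sup>4\<close> barely exceeds \<open>91 / 240\<close>.\<close>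

definition threshold :: "nat \<Rightarrow> nat \<Rightarrow> nat" where
  "threshold x y = (if 6 \<le> y then if 6 \<le> x then 5 else 9
              else if y = 5 then if 5 \<le> x then 5 else 6
              else if 5 \<le> x then 0 else if x < y then 6 else y + 1)"

lemma card_transitions_threshold:
  "card (transitions 9 {(x, y, z). threshold x y \<le> z}) = 2488"
proof -
  have "real (card (transitions 9 {(x, y, z). threshold x y \<le> z})) =
    (\<Sum>w<9. \<Sum>x<9. \<Sum>y<9. of_bool (threshold w x \<le> y) * real (threshold x y))"
  proof -
    have "(\<Sum>z<9. 1 - of_bool (threshold x y \<le> z)) = real (threshold x y)" for x y
    proof -
      \<comment> \<open>The number of letters \<open>z\<close> below the threshold equals the
        threshold only because it never exceeds 9; the value 9 itself means that no \<open>z\<close>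
        is accepted.\<close>
      have "threshold x y \<le> 9" by (simp add: threshold_def)
      then have "{..<9} \<inter> {z. z < threshold x y} = {..<threshold x y}" by auto
      moreover have "(\<Sum>z<9. 1 - of_bool (threshold x y \<le> z)) = (\<Sum>z<9. of_bool (z < threshold x y) :: real)"
        by (intro sum.cong) auto
      ultimately show ?thesis by (simp add: of_bool_def sum.If_cases)
    qed
    then show ?thesis
      unfolding card_transitions_eq_sum by (simp flip: sum_distrib_left)
  qed
  also have "\<dots> = 2488"
    by (simp add: threshold_def lessThan_nat_numeral lessThan_Suc)
  finally show ?thesis by linarith
qed

lemma alpha_loop4_upper: "real (alpha_loop4 q) \<le> 25 / 64 * real q ^ 4"
  by (rule alpha_loop4_le_card_transitions[of q]) (meson card_transitions_le of_nat_mono order_trans)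

subsection \<open>The functional as a Lebesgue measure\<close>

lemma nn_integral_lborel_Pair:
  fixes f :: "'a::euclidean_space \<times> 'b::euclidean_space \<Rightarrow> ennreal"
  assumes "f \<in> borel_measurable borel"
  shows "(\<integral>\<^sup>+x. f x \<partial>lborel) = (\<integral>\<^sup>+a. \<integral>\<^sup>+b. f (a, b) \<partial>lborel \<partial>lborel)"
  using assms lborel.nn_integral_fst[of f lborel] by (simp add: lborel_prod)

lemma borel_measurable_section:
  fixes f :: "'a::euclidean_space \<times> 'b::euclidean_space \<Rightarrow> ennreal"
  assumes "f \<in> borel_measurable borel"
  shows "(\<lambda>b. f (a, b)) \<in> borel_measurable borel"
  using assms by (rule measurable_compose[rotated])
    (intro borel_measurable_continuous_onI continuous_intros)

lemma emeasure_lborel_Times: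
  fixes A :: "'a::euclidean_space set" and B :: "'b::euclidean_space set"
  assumes "A \<in> sets borel" "B \<in> sets borel"
  shows "emeasure lborel (A \<times> B) = emeasure lborel A * emeasure lborel B"
  using assms lborel.emeasure_pair_measure_Times[of A lborel B] by (simp add: lborel_prod)

lemma emeasure_lborel_triple:
  fixes W :: "(real \<times> real \<times> real) set"
  assumes "W \<in> sets borel"
  shows "emeasure lborel W =
    (\<integral>\<^sup>+a. \<integral>\<^sup>+b. \<integral>\<^sup>+c. indicator W (a, b, c) \<partial>lborel \<partial>lborel \<partial>lborel)"
proof -
  have "emeasure lborel W = (\<integral>\<^sup>+x. indicator W x \<partial>lborel)"
    using assms by simp
  then show ?thesis
    using assms by (simp add: nn_integral_lborel_Pair borel_measurable_section del: nn_integral_indicator)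
qed

lemma emeasure_lborel_quadruple:
  fixes W :: "(real \<times> real \<times> real \<times> real) set"
  assumes "W \<in> sets borel"
  shows "emeasure lborel W =
    (\<integral>\<^sup>+a. \<integral>\<^sup>+b. \<integral>\<^sup>+c. \<integral>\<^sup>+d. indicator W (a, b, c, d) \<partial>lborel \<partial>lborel \<partial>lborel \<partial>lborel)"
proof -
  have "emeasure lborel W = (\<integral>\<^sup>+x. indicator W x \<partial>lborel)"
    using assms by simp
  then show ?thesis
    using assms by (simp add: nn_integral_lborel_Pair borel_measurable_section del: nn_integral_indicator)
qed

text \<open>Prefix counterpart of \<open>snd\<close>, which yields the suffix of a right-nested
  quadruple.\<close>

definition fst3 :: "'a \<times> 'b \<times> 'c \<times> 'd \<Rightarrow> 'a \<times> 'b \<times> 'c" where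
  "fst3 = (\<lambda>(a, b, c, d). (a, b, c))"

lemma fst3_apply [simp]: "fst3 (a, b, c, d) = (a, b, c)"
  by (simp add: fst3_def)

section \<open>Null sets under the prefix and suffix projections\<close>

lemma borel_measurable_fst3:
  "(fst3 :: real \<times> real \<times> real \<times> real \<Rightarrow> _) \<in> borel_measurable borel"
  unfolding fst3_def borel_prod[symmetric] by measurable

lemma borel_measurable_snd:
  "(snd :: real \<times> real \<times> real \<times> real \<Rightarrow> _) \<in> borel_measurable borel"
  unfolding borel_prod[symmetric] by measurable

lemma null_sets_vimage_fst3:
  fixes N :: "(real \<times> real \<times> real) set"
  assumes N: "N \<in> null_sets lborel"
  shows "fst3 -` N \<in> null_sets (lborel :: (real \<times> real \<times> real \<times> real) measure)"
proof
  have [measurable]: "N \<in> sets borel" using N by auto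
  have [measurable]: "N \<in> sets (borel \<Otimes>\<^sub>M borel \<Otimes>\<^sub>M borel)"
    unfolding borel_prod by measurable
  show *: "fst3 -` N \<in> sets (lborel :: (real \<times> real \<times> real \<times> real) measure)"
    using measurable_sets[OF borel_measurable_fst3, of N] by simp
  \<comment> \<open>The free last coordinate contributes the infinite length of the line; since
    \<open>0 * \<infinity> = 0\<close> in \<open>ennreal\<close>, the preimage is still
    null.\<close>
  have "emeasure lborel (fst3 -` N :: (real \<times> real \<times> real \<times> real) set) =
      (\<integral>\<^sup>+a. \<integral>\<^sup>+b. \<integral>\<^sup>+c. indicator N (a, b, c) * \<infinity> \<partial>lborel \<partial>lborel \<partial>lborel)"
    using * by (simp add: emeasure_lborel_quadruple indicator_vimage)
  also have "\<dots> = (\<integral>\<^sup>+a. \<integral>\<^sup>+b. \<integral>\<^sup>+c. indicator N (a, b, c) \<partial>lborel \<partial>lborel \<partial>lborel) * \<infinity>"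
    by (simp add: nn_integral_multc)
  also have "\<dots> = 0"
    using N by (simp flip: emeasure_lborel_triple add: null_setsD1)
  finally show "emeasure lborel (fst3 -` N :: (real \<times> real \<times> real \<times> real) set) = 0" .
qed

lemma null_sets_vimage_snd:
  fixes N :: "(real \<times> real \<times> real) set"
  assumes N: "N \<in> null_sets lborel"
  shows "snd -` N \<in> null_sets (lborel :: (real \<times> real \<times> real \<times> real) measure)"
proof
  have [measurable]: "N \<in> sets borel" using N by auto
  show *: "snd -` N \<in> sets (lborel :: (real \<times> real \<times> real \<times> real) measure)"
    using measurable_sets[OF borel_measurable_snd, of N] by simp
  show "emeasure lborel (snd -` N :: (real \<times> real \<times> real \<times> real) set) = 0"
    using * N by (simp add: emeasure_lborel_quadruple indicator_vimage null_setsD1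
        flip: emeasure_lborel_triple)
qed

section \<open>The continuous transition set and its Borel replacement\<close>

definition transition_set :: "(real \<times> real \<times> real) set \<Rightarrow> (real \<times> real \<times> real \<times> real) set" where
  "transition_set A = cube4 \<inter> (fst3 -` A - snd -` A)"

text \<open>The integrand is the indicator of the transition set; if that set is not measurable,
  both sides take the default value 0.\<close>

lemma Phi3_eq_measure: "Phi3 A = measure lebesgue (transition_set A)"
proof -
  have "Phi3 A = (\<integral>x. indicat_real (transition_set A) x \<partial>lebesgue)"
    unfolding Phi3_def set_lebesgue_integral_def
    by (intro Bochner_Integration.integral_cong)
       (auto simp: transition_set_def indicator_def)
  then show ?thesis by simp
qed

lemma sets_cube4 [measurable]: "cube4 \<in> sets borel"
  unfolding cube4_def by (intro borel_closed closed_Times closed_atLeastAtMost)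

lemma emeasure_cube4: "emeasure lborel cube4 = 1"
  unfolding cube4_def by (simp add: emeasure_lborel_Times closed_Times)

lemma sets_borel_transition_set: "A \<in> sets borel \<Longrightarrow> transition_set A \<in> sets borel"
  unfolding transition_set_def
  using measurable_sets[OF borel_measurable_fst3, of A] measurable_sets[OF borel_measurable_snd, of A]
  by (auto intro!: sets.Int sets.Diff)

text \<open>Iterated integration above is for Borel sets, whereas \<open>A\<close> is only Lebesgue
  measurable. Replacing \<open>A\<close> by a Borel set differing from it inside a null set alters
  the transition set only on null preimages.\<close>

lemma Phi3_borel_witness:
  assumes A: "A \<in> sets lebesgue"
  obtains S where "S \<in> sets borel" "ennreal (Phi3 A) = emeasure lborel (transition_set S)"
proof -
  obtain S N N' where S: "A = S \<union> N" "N \<subseteq> N'" "N' \<in> null_sets lborel" "S \<in> sets lborel"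
    using A by (rule sets_completionE)
  have W: "transition_set S \<in> sets borel"
    using S(4) by (intro sets_borel_transition_set) simp
  have fin: "emeasure lborel (transition_set S) < \<infinity>"
    using emeasure_mono[of "transition_set S" cube4 lborel] emeasure_cube4
    by (auto simp: transition_set_def intro: order_le_less_trans)
  have "fst3 -` N' \<union> snd -` N' \<in> null_sets lebesgue"
    by (intro null_sets.Un null_sets_completionI null_sets_vimage_fst3 null_sets_vimage_snd S)
  then have "negligible (fst3 -` N' \<union> snd -` N')"
    by (simp add: negligible_iff_null_sets)
  then have "negligible (transition_set S - transition_set A \<union> (transition_set A - transition_set S))"
    by (rule negligible_subset) (use S(1,2) in \<open>auto simp: transition_set_def\<close>)
  moreover have "transition_set S \<in> lmeasurable"
    using W fin by (auto simp: fmeasurable_def)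
  ultimately have "Phi3 A = measure lborel (transition_set S)"
    using W by (simp add: Phi3_eq_measure measure_negligible_symdiff measure_completion)
  with S(4) fin that show ?thesis
    by (simp add: emeasure_eq_ennreal_measure less_top)
qed

section \<open>Uniform letters in the unit interval\<close>

lemma nn_integral_uniform_unit:
  fixes g :: "real \<Rightarrow> ennreal"
  assumes "g \<in> borel_measurable borel" "\<And>x. x \<notin> {0..1} \<Longrightarrow> g x = 0"
  shows "(\<integral>\<^sup>+x. g x \<partial>uniform_measure lborel {0..1}) = (\<integral>\<^sup>+x. g x \<partial>lborel)"
proof -
  have "(\<integral>\<^sup>+x. g x * indicator {0..1} x \<partial>lborel) = (\<integral>\<^sup>+x. g x \<partial>lborel)"
    using assms(2) by (intro nn_integral_cong) (auto simp: indicator_def)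
  then show ?thesis
    using assms(1) by (simp add: nn_integral_uniform_measure divide_ennreal_def)
qed

lemma nn_integral_uniform_quadruple:
  assumes W: "W \<in> sets borel" "W \<subseteq> cube4"
  defines "U \<equiv> uniform_measure lborel {0..1::real}"
  shows "(\<integral>\<^sup>+a. \<integral>\<^sup>+b. \<integral>\<^sup>+c. \<integral>\<^sup>+d. indicator W (a, b, c, d) \<partial>U \<partial>U \<partial>U \<partial>U) = emeasure lborel W"
proof -
  have [measurable]: "W \<in> sets (borel \<Otimes>\<^sub>M borel \<Otimes>\<^sub>M borel \<Otimes>\<^sub>M borel)"
    unfolding borel_prod by (rule W)
  have out: "indicator W (a, b, c, d) = (0::ennreal)"
    if "a \<notin> {0..1} \<or> b \<notin> {0..1} \<or> c \<notin> {0..1} \<or> d \<notin> {0..1}" for a b c d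
    using that W(2) by (auto simp: cube4_def indicator_def)
  show ?thesis
    unfolding U_def emeasure_lborel_quadruple[OF W(1)]
    by (simp add: nn_integral_uniform_unit out del: atLeastAtMost_iff)
qed

subsection \<open>Random sampling\<close>

text \<open>Distinct coordinates of a product measure are independent. The four relevant ones are
  split off in turn, and the remaining coordinates carry total mass 1.\<close>

lemma sampling_nn_integral:
  fixes M :: "'a measure" and f :: "'a \<times> 'a \<times> 'a \<times> 'a \<Rightarrow> ennreal"
  assumes M: "prob_space M" and I: "finite I" "{i, j, k, l} \<subseteq> I" and "distinct [i, j, k, l]"
    and f [measurable]: "f \<in> borel_measurable (M \<Otimes>\<^sub>M M \<Otimes>\<^sub>M M \<Otimes>\<^sub>M M)"
  shows "(\<integral>\<^sup>+\<omega>. f (\<omega> i, \<omega> j, \<omega> k, \<omega> l) \<partial>Pi\<^sub>M I (\<lambda>_. M)) =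
    (\<integral>\<^sup>+a. \<integral>\<^sup>+b. \<integral>\<^sup>+c. \<integral>\<^sup>+d. f (a, b, c, d) \<partial>M \<partial>M \<partial>M \<partial>M)"
proof -
  interpret prob_space M by (rule M)
  interpret P: product_prob_space "\<lambda>_. M" I by unfold_locales
  define R where "R = I - {i, j, k, l}"
  have R: "finite R" "i \<notin> R" "j \<notin> R" "k \<notin> R" "l \<notin> R"
    using I by (auto simp: R_def)
  have ne: "i \<noteq> j" "i \<noteq> k" "i \<noteq> l" "j \<noteq> k" "j \<noteq> l" "k \<noteq> l"
    using assms by auto
  have I_eq: "I = insert i (insert j (insert k (insert l R)))"
    using I by (auto simp: R_def)
  interpret PR: prob_space "Pi\<^sub>M R (\<lambda>_. M)"
    by (intro prob_space_PiM M)
  have "(\<integral>\<^sup>+\<omega>. f (\<omega> i, \<omega> j, \<omega> k, \<omega> l) \<partial>Pi\<^sub>M I (\<lambda>_. M)) =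
      (\<integral>\<^sup>+a. \<integral>\<^sup>+\<omega>. f (a, \<omega> j, \<omega> k, \<omega> l) \<partial>Pi\<^sub>M (insert j (insert k (insert l R))) (\<lambda>_. M) \<partial>M)"
    unfolding I_eq using R ne by (subst P.product_nn_integral_insert_rev) auto
  also have "\<dots> = (\<integral>\<^sup>+a. \<integral>\<^sup>+b. \<integral>\<^sup>+\<omega>. f (a, b, \<omega> k, \<omega> l) \<partial>Pi\<^sub>M (insert k (insert l R)) (\<lambda>_. M) \<partial>M \<partial>M)"
    using R ne by (intro nn_integral_cong, subst P.product_nn_integral_insert_rev) auto
  also have "\<dots> = (\<integral>\<^sup>+a. \<integral>\<^sup>+b. \<integral>\<^sup>+c. \<integral>\<^sup>+\<omega>. f (a, b, c, \<omega> l) \<partial>Pi\<^sub>M (insert l R) (\<lambda>_. M) \<partial>M \<partial>M \<partial>M)"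
    using R ne by (intro nn_integral_cong, subst P.product_nn_integral_insert_rev) auto
  also have "\<dots> = (\<integral>\<^sup>+a. \<integral>\<^sup>+b. \<integral>\<^sup>+c. \<integral>\<^sup>+d. \<integral>\<^sup>+\<omega>. f (a, b, c, d) \<partial>Pi\<^sub>M R (\<lambda>_. M) \<partial>M \<partial>M \<partial>M \<partial>M)"
    using R ne by (intro nn_integral_cong, subst P.product_nn_integral_insert_rev) auto
  finally show ?thesis
    by (simp add: PR.emeasure_space_1)
qed

text \<open>Nested dependent sums let the cardinality be computed as a product, one letter at a
  time.\<close>

definition injective_words :: "nat \<Rightarrow> word4 set" where
  "injective_words q = (SIGMA i:{..<q}. SIGMA j:{..<q} - {i}. SIGMA k:{..<q} - {i, j}. {..<q} - {i, j, k})"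

text \<open>Truncated subtraction agrees with the count: for \<open>q \<le> 3\<close> some factor is
  0 and no word has four distinct letters.\<close>

lemma card_injective_words:
  "card (injective_words q) = q * ((q - 1) * ((q - 2) * (q - 3)))"
proof -
  have 3: "card ({..<q} - {i, j, k}) = q - 3" if "i < q" "j < q" "k < q" "i \<noteq> j" "i \<noteq> k" "j \<noteq> k" for i j k
    using that by (subst card_Diff_subset) auto
  have 2: "card ({..<q} - {i, j}) = q - 2" if "i < q" "j < q" "i \<noteq> j" for i j
    using that by (subst card_Diff_subset) auto
  have 1: "card ({..<q} - {i}) = q - 1" if "i < q" for i
    using that by (subst card_Diff_subset) auto
  have b: "card (SIGMA k:{..<q} - {i, j}. {..<q} - {i, j, k}) = (q - 2) * (q - 3)"
    if "i < q" "j < q" "i \<noteq> j" for i j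
    using that by (simp add: 3 2 numeral_2_eq_2 numeral_3_eq_3)
  have c: "card (SIGMA j:{..<q} - {i}. SIGMA k:{..<q} - {i, j}. {..<q} - {i, j, k}) = (q - 1) * ((q - 2) * (q - 3))"
    if "i < q" for i
    using that by (simp add: b 1 numeral_2_eq_2 numeral_3_eq_3)
  show ?thesis
    by (simp add: injective_words_def c numeral_2_eq_2 numeral_3_eq_3)
qed

text \<open>Sampling \<open>q\<close> independent uniform letters turns \<open>A\<close> into a random subset of \<open>[q]\<^sup>3\<close>;
  a word with four distinct letters is a transition with probability \<open>Phi3 A\<close>.\<close>

lemma Phi3_le_alpha_loop4:
  assumes A: "A \<in> sets lebesgue"
  shows "real (card (injective_words q)) * Phi3 A \<le> real (alpha_loop4 q)"
proof -
  obtain S where S: "S \<in> sets borel" "ennreal (Phi3 A) = emeasure lborel (transition_set S)"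
    using A by (rule Phi3_borel_witness)
  define W where "W = transition_set S"
  have W: "W \<in> sets borel" "W \<subseteq> cube4"
    using S(1) sets_borel_transition_set by (auto simp: W_def transition_set_def)
  have W4 [measurable]: "W \<in> sets (borel \<Otimes>\<^sub>M borel \<Otimes>\<^sub>M borel \<Otimes>\<^sub>M borel)"
    unfolding borel_prod by (rule W)
  define U where "U = uniform_measure lborel {0..1::real}"
  have [measurable_cong]: "sets U = sets borel"
    by (simp add: U_def)
  define P where "P = Pi\<^sub>M {..<q} (\<lambda>_. U)"
  have U: "prob_space U"
    unfolding U_def by (rule prob_space_uniform_measure) auto
  interpret P: prob_space P
    unfolding P_def by (intro prob_space_PiM U)
  let ?g = "\<lambda>(i, j, k, l) \<omega>. indicator W (\<omega> i, \<omega> j, \<omega> k, \<omega> l :: real) :: ennreal"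
  have integral: "(\<integral>\<^sup>+\<omega>. ?g w \<omega> \<partial>P) = ennreal (Phi3 A)" if "w \<in> injective_words q" for w
  proof -
    obtain i j k l where w: "w = (i, j, k, l)" by (cases w)
    have "(\<integral>\<^sup>+\<omega>. indicator W (\<omega> i, \<omega> j, \<omega> k, \<omega> l) \<partial>P)
        = (\<integral>\<^sup>+a. \<integral>\<^sup>+b. \<integral>\<^sup>+c. \<integral>\<^sup>+d. indicator W (a, b, c, d) \<partial>U \<partial>U \<partial>U \<partial>U)"
      unfolding P_def using that by (intro sampling_nn_integral U) (auto simp: w injective_words_def)
    then show ?thesis
      using W S(2) by (simp add: w nn_integral_uniform_quadruple U_def W_def[symmetric])
  qed
  have meas: "?g w \<in> borel_measurable P" if "w \<in> injective_words q" for w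
    using that unfolding P_def by (auto simp: injective_words_def split: prod.splits)
  \<comment> \<open>For one fixed sample, all counted words are transitions of the same triple set
    \<open>?A\<close>, so their number is at most \<open>alpha_loop4 q\<close>; taking expectations
    gives the claim.\<close>
  have pointwise: "(\<Sum>w\<in>injective_words q. ?g w \<omega>) \<le> ennreal (real (alpha_loop4 q))" for \<omega>
  proof -
    let ?A = "{(i, j, k). (\<omega> i, \<omega> j, \<omega> k) \<in> S}"
    have fin: "finite (injective_words q)"
      by (simp add: injective_words_def)
    have "(\<Sum>w\<in>injective_words q. ?g w \<omega>)
        = of_nat (card {w \<in> injective_words q. case w of (i, j, k, l) \<Rightarrow> (\<omega> i, \<omega> j, \<omega> k, \<omega> l) \<in> W})"
      using fin by (simp add: indicator_def split_def sum.If_cases Int_def)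
    also have "card {w \<in> injective_words q. case w of (i, j, k, l) \<Rightarrow> (\<omega> i, \<omega> j, \<omega> k, \<omega> l) \<in> W}
        \<le> card (transitions q ?A)"
      by (rule card_mono[OF finite_transitions])
         (auto simp: injective_words_def transitions_def words_def W_def transition_set_def)
    also have "\<dots> \<le> alpha_loop4 q"
      by (rule card_transitions_le_alpha_loop4)
    finally show ?thesis
      by (simp add: ennreal_of_nat_eq_real_of_nat)
  qed
  have "ennreal (real (card (injective_words q)) * Phi3 A) = (\<Sum>w\<in>injective_words q. \<integral>\<^sup>+\<omega>. ?g w \<omega> \<partial>P)"
    by (simp add: integral ennreal_mult' ennreal_of_nat_eq_real_of_nat)
  also have "\<dots> = (\<integral>\<^sup>+\<omega>. (\<Sum>w\<in>injective_words q. ?g w \<omega>) \<partial>P)"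
    by (intro nn_integral_sum[symmetric] meas)
  also have "\<dots> \<le> (\<integral>\<^sup>+\<omega>. ennreal (real (alpha_loop4 q)) \<partial>P)"
    by (intro nn_integral_mono pointwise)
  also have "\<dots> = ennreal (real (alpha_loop4 q))"
    by (simp add: P.emeasure_space_1)
  finally show ?thesis
    by simp
qed

text \<open>Provides the boundedness that makes the real-valued \<open>SUP\<close> in
  \<open>lambda3\<close> meaningful.\<close>

lemma Phi3_le_1: "Phi3 A \<le> 1"
proof (cases "transition_set A \<in> sets lebesgue")
  case True
  have "emeasure lebesgue (transition_set A) \<le> emeasure lebesgue cube4"
    by (intro emeasure_mono) (auto simp: transition_set_def)
  then show ?thesis
    by (simp add: Phi3_eq_measure measure_def emeasure_cube4 enn2real_leI)
next
  case False
  then show ?thesis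
    by (simp add: Phi3_eq_measure measure_notin_sets)
qed

lemma Phi3_le_lambda3:
  assumes "A \<in> sets lebesgue" "A \<subseteq> cube3"
  shows "Phi3 A \<le> lambda3"
  unfolding lambda3_def using assms
  by (intro cSUP_upper bdd_aboveI2[of _ _ 1] Phi3_le_1) auto

lemma lambda3_le_alpha_loop4:
  "real (card (injective_words q)) * lambda3 \<le> real (alpha_loop4 q)"
proof (cases "card (injective_words q) = 0")
  case False
  have "lambda3 \<le> real (alpha_loop4 q) / real (card (injective_words q))"
    unfolding lambda3_def
  proof (rule cSUP_least)
    show "{A. A \<in> sets lebesgue \<and> A \<subseteq> cube3} \<noteq> {}" by auto
    show "Phi3 A \<le> real (alpha_loop4 q) / real (card (injective_words q))"
      if "A \<in> {A. A \<in> sets lebesgue \<and> A \<subseteq> cube3}" for A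
      using Phi3_le_alpha_loop4[of A q] False that by (simp add: field_simps)
  qed
  then show ?thesis
    using False by (simp add: field_simps)
qed simp

subsection \<open>Blow-ups\<close>

text \<open>Half-open intervals keep the cells of different letters disjoint.\<close>

definition cell :: "nat \<Rightarrow> nat \<Rightarrow> real set" where
  "cell q i = {real i / real q..<(real i + 1) / real q}"

lemma cell_unique:
  assumes "x \<in> cell q i" "x \<in> cell q j"
  shows "i = j"
proof -
  have "q > 0" using assms by (cases q) (auto simp: cell_def)
  then have "real i \<le> x * real q" "x * real q < real i + 1" "real j \<le> x * real q" "x * real q < real j + 1"
    using assms by (auto simp: cell_def field_simps)
  then show ?thesis by linarith
qed

lemma cell_subset:
  assumes i: "i < q"
  shows "cell q i \<subseteq> {0..1}"
proof
  fix x assume x: "x \<in> cell q i"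
  have "real i + 1 \<le> real q" using i by linarith
  then have "(real i + 1) / real q \<le> 1" by (simp add: divide_le_eq_1)
  moreover have "0 \<le> real i / real q" by simp
  ultimately show "x \<in> {0..1}" using x unfolding cell_def atLeastLessThan_iff atLeastAtMost_iff by linarith
qed

text \<open>At \<open>q = 0\<close> the cell is empty and \<open>1 / 0 = 0\<close>, so the formula
  persists.\<close>

lemma emeasure_cell: "emeasure lborel (cell q i) = ennreal (1 / real q)"
proof -
  have "(real i + 1) / real q - real i / real q = 1 / real q"
    by (simp add: diff_divide_distrib[symmetric])
  moreover have "real i / real q \<le> (real i + 1) / real q"
    by (simp add: divide_right_mono)
  ultimately show ?thesis
    by (simp add: cell_def)
qed

lemma sets_cell [measurable]: "cell q i \<in> sets borel"
  by (simp add: cell_def)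

text \<open>Replacing letters by cells turns an optimal triple set into a union \<open>B\<close> of
  boxes. Each discrete transition then contributes a disjoint box of volume \<open>1 / q^4\<close>
  to the transition set of \<open>B\<close>.\<close>

lemma alpha_loop4_le_lambda3: "real (alpha_loop4 q) \<le> lambda3 * real q ^ 4"
proof (cases "q = 0")
  case True
  then have "transitions q A = {}" for A
    using transitions_subset_words[of q A] by (simp add: words_def)
  then have "alpha_loop4 q \<le> 0"
    by (metis alpha_loop4_le_card_transitions card.empty)
  then show ?thesis
    using True by simp
next
  case False
  obtain A where A: "alpha_loop4 q \<le> card (transitions q A)"
    by (rule alpha_loop4_le_card_transitions)
  define B where "B = (\<Union>(i, j, k)\<in>A \<inter> {..<q} \<times> {..<q} \<times> {..<q}. cell q i \<times> cell q j \<times> cell q k)"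
  have B_iff: "(a, b, c) \<in> B \<longleftrightarrow> (i, j, k) \<in> A"
    if "a \<in> cell q i" "b \<in> cell q j" "c \<in> cell q k" "i < q" "j < q" "k < q" for a b c i j k
  proof -
    have "a \<in> cell q i' \<longleftrightarrow> i' = i" "b \<in> cell q i' \<longleftrightarrow> i' = j" "c \<in> cell q i' \<longleftrightarrow> i' = k" for i'
      using that(1-3) cell_unique by blast+
    then show ?thesis
      using that(4-6) by (auto simp: B_def intro!: bexI[of _ "(i, j, k)"])
  qed
  have "finite (A \<inter> {..<q} \<times> {..<q} \<times> {..<q})"
    by simp
  then have "B \<in> sets borel"
    unfolding B_def
    by (intro sets.finite_UN) (auto simp: borel_prod[symmetric] intro!: pair_measureI)
  moreover have "B \<subseteq> cube3"
    unfolding B_def cube3_def by (auto dest!: subsetD[OF cell_subset])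
  ultimately have B: "Phi3 B \<le> lambda3" "transition_set B \<in> sets borel"
    by (auto intro!: Phi3_le_lambda3 sets_borel_transition_set)
  define box4 where "box4 = (\<lambda>(i, j, k, l). cell q i \<times> cell q j \<times> cell q k \<times> cell q l)"
  have box4_sets: "box4 w \<in> sets lborel" for w
    by (auto simp: box4_def borel_prod[symmetric] intro!: pair_measureI split: prod.splits)
  have box4_measure: "emeasure lborel (box4 w) = ennreal (1 / real q ^ 4)" for w
  proof -
    have *: "cell q k \<times> cell q l \<in> sets borel" "cell q j \<times> cell q k \<times> cell q l \<in> sets borel" for j k l
      by (auto simp: borel_prod[symmetric] intro!: pair_measureI)
    show ?thesis
      by (cases w) (simp add: box4_def emeasure_lborel_Times * emeasure_cell power4_eq_xxxx
          flip: ennreal_mult)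
  qed
  have "ennreal (real (card (transitions q A)) / real q ^ 4) = (\<Sum>w\<in>transitions q A. emeasure lborel (box4 w))"
    by (simp add: box4_measure ennreal_of_nat_eq_real_of_nat flip: ennreal_mult')
  also have "\<dots> = emeasure lborel (\<Union>w\<in>transitions q A. box4 w)"
  proof (rule sum_emeasure)
    show "box4 ` transitions q A \<subseteq> sets lborel" using box4_sets by auto
    show "disjoint_family_on box4 (transitions q A)"
      using cell_unique by (auto simp: disjoint_family_on_def box4_def)
  qed simp
  also have "\<dots> \<le> emeasure lborel (transition_set B)"
  proof (rule emeasure_mono)
    show "(\<Union>w\<in>transitions q A. box4 w) \<subseteq> transition_set B"
      by (auto simp: transitions_def words_def box4_def transition_set_def cube4_def B_iff
          dest: subsetD[OF cell_subset])
    show "transition_set B \<in> sets lborel" using B by simp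
  qed
  also have "\<dots> = ennreal (Phi3 B)"
  proof -
    have "emeasure lborel (transition_set B) \<le> emeasure lborel cube4"
      by (intro emeasure_mono) (auto simp: transition_set_def)
    then have "emeasure lborel (transition_set B) \<noteq> \<infinity>"
      by (auto simp: emeasure_cube4 top_unique)
    then show ?thesis
      using B by (simp add: Phi3_eq_measure emeasure_eq_ennreal_measure measure_completion)
  qed
  finally have "real (card (transitions q A)) / real q ^ 4 \<le> Phi3 B"
    by (simp add: Phi3_eq_measure)
  then have "real (card (transitions q A)) \<le> Phi3 B * real q ^ 4"
    using False by (simp add: field_simps)
  also have "\<dots> \<le> lambda3 * real q ^ 4"
    using B(1) by (intro mult_right_mono) simp_all
  finally show ?thesis
    using A by linarith
qed

subsection \<open>Asymptotics\<close>

text \<open>For \<open>q \<ge> 3\<close> the omitted part of the expanded product,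
  \<open>11 * q^2 - 6 * q\<close>, is nonnegative; for smaller \<open>q\<close> the left side is at
  most 0.\<close>

lemma card_injective_words_asymp:
  "real q ^ 4 - 6 * real q ^ 3 \<le> real (card (injective_words q))"
proof (cases "q \<ge> 3")
  case True
  then have "real (card (injective_words q)) = real q * ((real q - 1) * ((real q - 2) * (real q - 3)))"
    by (simp add: card_injective_words of_nat_diff)
  also have "\<dots> = real q ^ 4 - 6 * real q ^ 3 + real q * (11 * real q - 6)"
    by (simp add: algebra_simps power4_eq_xxxx power3_eq_cube)
  finally show ?thesis
    using True by simp
next
  case False
  then have "real q ^ 3 * real q \<le> real q ^ 3 * 6"
    by (intro mult_left_mono) auto
  then have "real q ^ 4 - 6 * real q ^ 3 \<le> 0"
    by (simp add: power4_eq_xxxx power3_eq_cube mult.assoc)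
  then show ?thesis
    by (rule order_trans) simp
qed

lemma lambda3_nonneg: "0 \<le> lambda3"
  using alpha_loop4_le_lambda3[of 1] by (metis mult.right_neutral of_nat_0_le_iff of_nat_1 order_trans power_one)

text \<open>The nine-letter example suffices narrowly: \<open>2488 * 240 = 597120\<close> against
  \<open>91 * 9^4 = 597051\<close>.\<close>

lemma lambda3_lower: "91 / 240 \<le> lambda3"
proof -
  have "real 2488 \<le> lambda3 * real 9 ^ 4"
    using card_transitions_le_alpha_loop4[of 9 "{(x, y, z). threshold x y \<le> z}"] alpha_loop4_le_lambda3[of 9]
    by (simp add: card_transitions_threshold)
  then show ?thesis by simp
qed

lemma alpha_loop4_lower: "lambda3 * real q ^ 4 - 6 * lambda3 * real q ^ 3 \<le> real (alpha_loop4 q)"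
proof -
  have "(real q ^ 4 - 6 * real q ^ 3) * lambda3 \<le> real (card (injective_words q)) * lambda3"
    by (intro mult_right_mono card_injective_words_asymp lambda3_nonneg)
  with lambda3_le_alpha_loop4[of q] show ?thesis
    by (simp add: algebra_simps)
qed

lemma smallo_of_cubic_bound:
  fixes g :: "nat \<Rightarrow> real"
  assumes "\<And>q. \<bar>g q\<bar> \<le> c * real q ^ 3"
  shows "g \<in> o(\<lambda>q. real q ^ 4)"
proof -
  have "g \<in> O(\<lambda>q. real q ^ 3)"
    using assms by (intro bigoI[of _ c]) auto
  also have "(\<lambda>q. real q ^ 3) \<in> o(\<lambda>q. real q ^ 4)"
    by real_asymp
  finally show ?thesis .
qed

lemma alpha_loop4_asymp: "(\<lambda>q. real (alpha_loop4 q) - lambda3 * real q ^ 4) \<in> o(\<lambda>q. real q ^ 4)"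
proof (rule smallo_of_cubic_bound)
  show "\<bar>real (alpha_loop4 q) - lambda3 * real q ^ 4\<bar> \<le> (6 * lambda3) * real q ^ 3" for q
    using alpha_loop4_lower[of q] alpha_loop4_le_lambda3[of q] by linarith
qed

lemma alpha4_asymp: "(\<lambda>q. real (alpha4 q) - lambda3 * real q ^ 4) \<in> o(\<lambda>q. real q ^ 4)"
proof -
  have "(\<lambda>q. real (alpha4 q) - real (alpha_loop4 q)) \<in> o(\<lambda>q. real q ^ 4)"
  proof (rule smallo_of_cubic_bound)
    fix q
    have "real q \<le> real q ^ 3"
      by (cases "q = 0") (auto intro: self_le_power)
    then show "\<bar>real (alpha4 q) - real (alpha_loop4 q)\<bar> \<le> 1 * real q ^ 3"
      using alpha_loop4_le_alpha4[of q] alpha4_le[of q] by linarith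
  qed
  from sum_in_smallo(1)[OF this alpha_loop4_asymp] show ?thesis by simp
qed

text \<open>The finite bound 25/64 holds for every \<open>q\<close>. Any excess of
  \<open>lambda3\<close> over it would produce a quartic gain that eventually beats the cubic
  sampling loss.\<close>

lemma lambda3_upper: "lambda3 \<le> 25 / 64"
proof (rule ccontr)
  assume "\<not> lambda3 \<le> 25 / 64"
  then obtain q where q: "6 * lambda3 < real q * (lambda3 - 25 / 64)"
    using reals_Archimedean3[of "lambda3 - 25 / 64"] by auto
  then have "q > 0"
    using lambda3_nonneg by (cases q) auto
  have "lambda3 * real q ^ 4 - 6 * lambda3 * real q ^ 3 \<le> 25 / 64 * real q ^ 4"
    using alpha_loop4_lower[of q] alpha_loop4_upper[of q] by linarith
  then have "real q ^ 3 * (real q * (lambda3 - 25 / 64) - 6 * lambda3) \<le> 0"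
    by (simp add: algebra_simps power4_eq_xxxx power3_eq_cube)
  then show False
    using q \<open>q > 0\<close> by (simp add: mult_le_0_iff)
qed

theorem theorem3p10:
  shows "(\<lambda>q. real (alpha4 q) - lambda3 * real q ^ 4) \<in> o(\<lambda>q. real q ^ 4) \<and>
    91 / 240 \<le> lambda3 \<and> lambda3 \<le> 11 / 28 \<and>
    (\<exists>e1 e2. e1 \<in> o(\<lambda>q. real q ^ 4) \<and> e2 \<in> o(\<lambda>q. real q ^ 4) \<and>
      (\<forall>q. 91 / 240 * real q ^ 4 + e1 q \<le> real (alpha4 q) \<and>
           real (alpha4 q) \<le> 11 / 28 * real q ^ 4 + e2 q)) \<and>
    (\<lambda>q. real (alpha_loop4 q) - lambda3 * real q ^ 4) \<in> o(\<lambda>q. real q ^ 4) \<and>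
    (\<exists>e1 e2. e1 \<in> o(\<lambda>q. real q ^ 4) \<and> e2 \<in> o(\<lambda>q. real q ^ 4) \<and>
      (\<forall>q. 91 / 240 * real q ^ 4 + e1 q \<le> real (alpha_loop4 q) \<and>
           real (alpha_loop4 q) \<le> 11 / 28 * real q ^ 4 + e2 q))"
proof -
  have lower: "91 / 240 * real q ^ 4 \<le> lambda3 * real q ^ 4" for q
    by (intro mult_right_mono lambda3_lower) simp
  have upper: "lambda3 \<le> 11 / 28"
    using lambda3_upper by simp
  then have upper': "lambda3 * real q ^ 4 \<le> 11 / 28 * real q ^ 4" for q
    by (intro mult_right_mono) simp_all
  have bounds: "\<exists>e1 e2. e1 \<in> o(\<lambda>q. real q ^ 4) \<and> e2 \<in> o(\<lambda>q. real q ^ 4) \<and>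
      (\<forall>q. 91 / 240 * real q ^ 4 + e1 q \<le> a q \<and> a q \<le> 11 / 28 * real q ^ 4 + e2 q)"
    if "(\<lambda>q. a q - lambda3 * real q ^ 4) \<in> o(\<lambda>q. real q ^ 4)" for a :: "nat \<Rightarrow> real"
    \<comment> \<open>The deviation from \<open>lambda3 * q^4\<close> serves as both error
      terms.\<close>
    using that lower upper' by (intro exI[of _ "\<lambda>q. a q - lambda3 * real q ^ 4"]) simp
  show ?thesis
    using alpha4_asymp alpha_loop4_asymp lambda3_lower upper
      bounds[OF alpha4_asymp] bounds[OF alpha_loop4_asymp] by blast
qed

end
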